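(* Let $\mathcal{H}$ be a real Hilbert space and let $f:\mathcal{H}\to\mathbb{R}$ be convex and continuously differentiable with $\operatorname{argmin} f\ne\emptyset$. Let $\alpha>3$, $s_0>0$, $x_0,x_1\in\mathcal{H}$, and let $x:[s_0,+\infty)\to\mathcal{H}$ be a solution of $$\begin{cases}\ddot x(s)+\frac{\alpha}{s}\dot x(s)+\nabla f(x(s))=0,\\ x(s_0)=x_0,\quad\dot x(s_0)=x_1.\end{cases}$$ Then $$f(x(s))-\inf\nolimits_{\mathcal{H}}f=o\left(\frac1{s^2}\right)\quad\text{and}\quad\|\dot x(s)\|=o\left(\frac1s\right)\quad\text{as } s\to+\infty .$$ Furthermore, $x(s)$ converges weakly to an element of $\operatorname{argmin} f$ as $s\to+\infty$.
   Context: A solution is a twice continuously differentiable function $x:[s_0,+\infty)\to\mathcal{H}$ satisfying the equation for every $s\ge s_0$ and the initial conditions (derivatives at $s_0$ are one-sided). *)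

theory Defs
  imports "HOL-Analysis.Analysis" "HOL-Library.Landau_Symbols"
begin

text \<open>
  Real Hilbert spaces are the types of sort \<open>{real_inner, complete_space}\<close>.
\<close>

definition continuously_differentiable :: "('a::real_normed_vector \<Rightarrow> real) \<Rightarrow> bool" where
  "continuously_differentiable f \<longleftrightarrow>
     (\<exists>f' :: 'a \<Rightarrow> 'a \<Rightarrow>\<^sub>L real.
        (\<forall>x. (f has_derivative blinfun_apply (f' x)) (at x)) \<and> continuous_on UNIV f')"

definition gradient :: "('a::real_inner \<Rightarrow> real) \<Rightarrow> 'a \<Rightarrow> 'a" where
  "gradient f x = (THE D. GDERIV f x :> D)"

text \<open>
  The Riesz representation theorem, which makes the gradient of a differentiable function
  on a Hilbert space well-defined. The representing vector minimises
  \<open>norm x ^ 2 / 2 - \<phi> x\<close>.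
\<close>

lemma riesz_representation:
  fixes \<phi> :: "'a::{real_inner,complete_space} \<Rightarrow> real"
  assumes "bounded_linear \<phi>"
  shows "\<exists>d. \<forall>h. \<phi> h = h \<bullet> d"
proof -
  interpret bounded_linear \<phi> by fact
  define J where "J x = x \<bullet> x / 2 - \<phi> x" for x
  obtain K where K: "\<And>x. norm (\<phi> x) \<le> norm x * K"
    using bounded by blast
  have "- (K\<^sup>2 / 2) \<le> J x" for x
  proof -
    have "0 \<le> (norm x - K)\<^sup>2" by simp
    then show ?thesis
      using K[of x] by (simp add: J_def power2_eq_square dot_square_norm algebra_simps)
  qed
  then have bdd: "bdd_below (range J)" by (auto simp: bdd_below_def)
  define m where "m = Inf (range J)"
  have m_le: "m \<le> J x" for x
    unfolding m_def by (rule cInf_lower[OF _ bdd]) simp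
  have "\<exists>x. J x < m + 1 / real (Suc n)" for n
    using cInf_lessD[of "range J" "m + 1 / real (Suc n)"] by (auto simp: m_def)
  then obtain X where X: "\<And>n. J (X n) < m + 1 / real (Suc n)" by metis
  have par: "(norm (x - y))\<^sup>2 = 4 * (J x + J y - 2 * J ((1/2) *\<^sub>R (x + y)))" for x y
    unfolding J_def
    by (simp add: add scale power2_norm_eq_inner inner_add inner_diff inner_commute field_simps)
  have close: "(norm (X i - X j))\<^sup>2 \<le> 8 / real (Suc N)" if "i \<ge> N" "j \<ge> N" for i j N
  proof -
    have "1 / real (Suc i) \<le> 1 / real (Suc N)" "1 / real (Suc j) \<le> 1 / real (Suc N)"
      using that by (auto intro!: divide_left_mono)
    then show ?thesis
      using par[of "X i" "X j"] X[of i] X[of j] m_le[of "(1/2) *\<^sub>R (X i + X j)"] by simp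
  qed
  have "Cauchy X"
  proof (rule metric_CauchyI)
    fix e :: real assume "e > 0"
    obtain N where "8 / e\<^sup>2 < real N" using reals_Archimedean2 by blast
    then have N: "8 / real (Suc N) < e\<^sup>2"
      using \<open>e > 0\<close> by (simp add: field_simps)
         (metis add.commute add_strict_increasing2 zero_less_power less_eq_real_def)
    have "dist (X i) (X j) < e" if "i \<ge> N" "j \<ge> N" for i j
      using close[OF that] N \<open>e > 0\<close> by (auto simp: dist_norm intro: power2_less_imp_less)
    then show "\<exists>M. \<forall>i\<ge>M. \<forall>j\<ge>M. dist (X i) (X j) < e" by blast
  qed
  then obtain d where d: "X \<longlonglongrightarrow> d" using Cauchy_convergent_iff convergent_def by blast
  have "(\<lambda>n. J (X n)) \<longlonglongrightarrow> J d"
    unfolding J_def by (intro tendsto_intros tendsto d) simp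
  moreover have "(\<lambda>n. m + 1 / real (Suc n)) \<longlonglongrightarrow> m + 0"
    by (intro tendsto_intros LIMSEQ_Suc lim_1_over_n)
  ultimately have Jd: "J d \<le> m"
    using X by (force intro: LIMSEQ_le less_imp_le)
  have "\<phi> h = h \<bullet> d" for h
  proof (rule ccontr)
    define c where "c = h \<bullet> d - \<phi> h"
    assume "\<phi> h \<noteq> h \<bullet> d"
    then have "c \<noteq> 0" "h \<noteq> 0" by (auto simp: c_def zero)
    then have hh: "h \<bullet> h > 0" by simp
    have "J (d + t *\<^sub>R h) = J d + t * c + t\<^sup>2 * (h \<bullet> h) / 2" for t
      unfolding J_def c_def
      by (simp add: add scale inner_add inner_commute power2_eq_square field_simps)
    moreover have "J d \<le> J (d + t *\<^sub>R h)" for t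
      using Jd m_le order_trans by blast
    ultimately have "0 \<le> t * c + t\<^sup>2 * (h \<bullet> h) / 2" for t
      by (metis add.assoc le_add_same_cancel1)
    from this[of "- c / (h \<bullet> h)"] have "0 \<le> - (c\<^sup>2 / (h \<bullet> h)) / 2"
      using hh by (simp add: power2_eq_square field_simps)
    then show False using hh \<open>c \<noteq> 0\<close> by (simp add: field_simps)
  qed
  then show ?thesis by blast
qed

lemma gradient_eqI:
  assumes "GDERIV f x :> D"
  shows "gradient f x = D"
  unfolding gradient_def
proof (rule the_equality)
  show "GDERIV f x :> D" by fact
next
  fix E assume "GDERIV f x :> E"
  with assms have "(\<lambda>h. h \<bullet> E) = (\<lambda>h. h \<bullet> D)"
    unfolding gderiv_def by (rule has_derivative_unique[rotated])
  then show "E = D" by (metis inner_commute vector_eq_ldot)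
qed

lemma gderiv_gradient:
  fixes f :: "'a::{real_inner,complete_space} \<Rightarrow> real"
  assumes "f differentiable (at x)"
  shows "GDERIV f x :> gradient f x"
proof -
  obtain f' where f': "(f has_derivative f') (at x)"
    using assms by (auto simp: differentiable_def)
  obtain d where "\<forall>h. f' h = h \<bullet> d"
    using riesz_representation[OF has_derivative_bounded_linear[OF f']] by blast
  then have "f' = (\<lambda>h. h \<bullet> d)" by blast
  with f' have "GDERIV f x :> d" by (simp add: gderiv_def)
  then show ?thesis by (simp add: gradient_eqI)
qed

definition argmin :: "('a \<Rightarrow> real) \<Rightarrow> 'a set" where
  "argmin f = {z. is_arg_min f (\<lambda>_. True) z}"

definition weakly_tendsto :: "('b \<Rightarrow> 'a::real_normed_vector) \<Rightarrow> 'a \<Rightarrow> 'b filter \<Rightarrow> bool" where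
  "weakly_tendsto x l F \<longleftrightarrow>
     (\<forall>\<phi> :: 'a \<Rightarrow> real. bounded_linear \<phi> \<longrightarrow> ((\<lambda>s. \<phi> (x s)) \<longlongrightarrow> \<phi> l) F)"

text \<open>
  Trajectories on \<open>[s0, \<infinity>)\<close> are total functions of which only the values on \<open>{s0..}\<close> matter.
  Derivatives are taken within \<open>{s0..}\<close>: they are two-sided for \<open>s > s0\<close> and one-sided at \<open>s0\<close>.
\<close>

definition velocity :: "real \<Rightarrow> (real \<Rightarrow> 'a::real_normed_vector) \<Rightarrow> real \<Rightarrow> 'a" where
  "velocity s0 x s = vector_derivative x (at s within {s0..})"

definition acceleration :: "real \<Rightarrow> (real \<Rightarrow> 'a::real_normed_vector) \<Rightarrow> real \<Rightarrow> 'a" where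
  "acceleration s0 x s = vector_derivative (velocity s0 x) (at s within {s0..})"

definition twice_continuously_differentiable ::
    "real \<Rightarrow> (real \<Rightarrow> 'a::real_normed_vector) \<Rightarrow> bool" where
  "twice_continuously_differentiable s0 x \<longleftrightarrow>
     x differentiable_on {s0..} \<and> velocity s0 x differentiable_on {s0..} \<and>
     continuous_on {s0..} (acceleration s0 x)"

definition is_solution ::
    "('a::real_inner \<Rightarrow> real) \<Rightarrow> real \<Rightarrow> real \<Rightarrow> 'a \<Rightarrow> 'a \<Rightarrow> (real \<Rightarrow> 'a) \<Rightarrow> bool" where
  "is_solution f \<alpha> s0 x0 x1 x \<longleftrightarrow>
     twice_continuously_differentiable s0 x \<and>
     (\<forall>s\<ge>s0. acceleration s0 x s + (\<alpha> / s) *\<^sub>R velocity s0 x s + gradient f (x s) = 0) \<and>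
     x s0 = x0 \<and> velocity s0 x s0 = x1"

end

theory Submission
  imports Defs "HOL-Real_Asymp.Real_Asymp"
begin

text \<open>
  For a minimiser \<open>z\<close> and \<open>2 \<le> l \<le> \<alpha> - 1\<close> the energy
  \<open>s\<^sup>2 (f x - min f) + \<bar>l (x - z) + s v\<bar>\<^sup>2 / 2 + l (\<alpha> - 1 - l) \<bar>x - z\<bar>\<^sup>2 / 2\<close>
  is nonincreasing. It is affine in \<open>l\<close>, namely \<open>s\<^sup>2 W + l p\<close> where \<open>W\<close> is the mechanical energy and
  \<open>p = s \<langle>x - z, v\<rangle> + (\<alpha> - 1) / 2 \<bar>x - z\<bar>\<^sup>2\<close>, so that comparing two values of \<open>l\<close> shows that
  \<open>s\<^sup>2 W\<close> and \<open>p\<close> converge separately. The dissipation for an intermediate \<open>l\<close> is at least a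
  multiple of \<open>s W\<close>, which forces the limit of \<open>s\<^sup>2 W\<close> to be zero. Convergence of \<open>p\<close> implies that
  of \<open>\<bar>x - z\<bar>\<close>, and weak convergence follows by Opial's argument; weak cluster points are obtained
  from Tychonoff's theorem applied to \<open>h \<mapsto> \<langle>x s, h\<rangle>\<close>.
\<close>

section \<open>Weak cluster points and Opial's lemma\<close>

text \<open>Eventually the functionals \<open>h \<mapsto> x s \<bullet> h\<close> lie in a product
  of compact intervals. By Tychonoff they cluster pointwise at some \<open>\<psi>\<close>, which is
  again linear and bounded and hence represented by a vector. A finer filter \<open>G\<close> takes
  the place of a subsequence.\<close>

lemma bounded_has_weak_cluster_point:
  fixes x :: "'b \<Rightarrow> 'a::{real_inner,complete_space}"
  assumes "F \<noteq> bot" and bnd: "eventually (\<lambda>s. norm (x s) \<le> M) F"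
  obtains G z where "G \<noteq> bot" "G \<le> F" "\<And>h. ((\<lambda>s. x s \<bullet> h) \<longlongrightarrow> z \<bullet> h) G"
proof -
  define T :: "'b \<Rightarrow> 'a \<Rightarrow> real" where "T s h = x s \<bullet> h" for s h
  define K :: "('a \<Rightarrow> real) set" where "K = (\<Pi>\<^sub>E h\<in>UNIV. {- (M * norm h)..M * norm h})"
  have K: "compact K"
    unfolding K_def using compactin_PiE[of "\<lambda>_. euclidean" UNIV "\<lambda>h. {- (M * norm h)..M * norm h}"]
    by (simp add: euclidean_product_topology)
  have "eventually (\<lambda>s. T s \<in> K) F"
    using bnd
  proof eventually_elim
    case (elim s)
    have "\<bar>x s \<bullet> h\<bar> \<le> M * norm h" for h
      using Cauchy_Schwarz_ineq2[of "x s" h] mult_right_mono[OF elim, of "norm h"] by simp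
    then show ?case by (auto simp: K_def T_def abs_le_iff PiE_def)
       (smt (verit, best))+
  qed
  then have "eventually (\<lambda>\<psi>. \<psi> \<in> K) (filtermap T F)"
    by (simp add: eventually_filtermap)
  moreover have "filtermap T F \<noteq> bot"
    using \<open>F \<noteq> bot\<close> by (simp add: filtermap_bot_iff)
  ultimately obtain \<psi> where "\<psi> \<in> K" and \<psi>: "inf (nhds \<psi>) (filtermap T F) \<noteq> bot"
    using K unfolding compact_filter by blast
  \<comment> \<open>The cluster filter lives on functionals. Pulling the neighbourhoods of
    \<open>\<psi>\<close> back along \<open>T\<close> moves it to the parameters, and
    \<open>G\<close> is proper because \<open>\<psi>\<close> is a cluster point.\<close>
  define G where "G = inf (filtercomap T (nhds \<psi>)) F"
  have "G \<noteq> bot"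
  proof
    assume "G = bot"
    then have "eventually (\<lambda>_. False) G" by simp
    then obtain P Q where P: "eventually P (nhds \<psi>)" and Q: "eventually Q F"
      and PQ: "\<And>s. P (T s) \<Longrightarrow> Q s \<Longrightarrow> False"
      unfolding G_def eventually_inf eventually_filtercomap by blast
    have "eventually (\<lambda>\<eta>. \<not> P \<eta>) (filtermap T F)"
      unfolding eventually_filtermap by (rule eventually_mono[OF Q]) (use PQ in blast)
    with P have "eventually (\<lambda>_. False) (inf (nhds \<psi>) (filtermap T F))"
      unfolding eventually_inf by blast
    with \<psi> show False by (simp add: trivial_limit_def)
  qed
  have "filterlim T (nhds \<psi>) G"
    unfolding filterlim_iff_le_filtercomap G_def by simp
  then have lim: "((\<lambda>s. x s \<bullet> h) \<longlongrightarrow> \<psi> h) G" for h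
    using continuous_on_tendsto_compose[OF continuous_on_product_coordinates[of h], of T \<psi> G]
    by (simp add: T_def)
  have "bounded_linear \<psi>"
  proof (rule bounded_linear_intro)
    show "\<psi> (h + k) = \<psi> h + \<psi> k" for h k
      using tendsto_unique[OF \<open>G \<noteq> bot\<close> lim[of "h + k"]] tendsto_add[OF lim[of h] lim[of k]]
      by (simp add: inner_add_right)
    show "\<psi> (r *\<^sub>R h) = r *\<^sub>R \<psi> h" for r h
      using tendsto_unique[OF \<open>G \<noteq> bot\<close> lim[of "r *\<^sub>R h"]] tendsto_mult[OF tendsto_const lim[of h]]
      by simp
    show "norm (\<psi> h) \<le> norm h * M" for h
      using \<open>\<psi> \<in> K\<close> by (auto simp: K_def PiE_def Pi_def abs_le_iff algebra_simps)
        (smt (verit))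
  qed
  then obtain z where "\<And>h. \<psi> h = z \<bullet> h"
    using riesz_representation by (metis inner_commute)
  with lim \<open>G \<noteq> bot\<close> show thesis
    by (intro that[of G z]) (auto simp: G_def)
qed

lemma weakly_tendsto_iff_inner:
  fixes x :: "'b \<Rightarrow> 'a::{real_inner,complete_space}"
  shows "weakly_tendsto x z F \<longleftrightarrow> (\<forall>h. ((\<lambda>s. x s \<bullet> h) \<longlongrightarrow> z \<bullet> h) F)"
proof
  assume "weakly_tendsto x z F"
  then show "\<forall>h. ((\<lambda>s. x s \<bullet> h) \<longlongrightarrow> z \<bullet> h) F"
    unfolding weakly_tendsto_def using bounded_linear_inner_left by blast
next
  assume *: "\<forall>h. ((\<lambda>s. x s \<bullet> h) \<longlongrightarrow> z \<bullet> h) F"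
  show "weakly_tendsto x z F"
    unfolding weakly_tendsto_def
  proof (intro allI impI)
    fix \<phi> :: "'a \<Rightarrow> real" assume "bounded_linear \<phi>"
    then obtain d where "\<And>h. \<phi> h = h \<bullet> d" using riesz_representation by blast
    with * show "((\<lambda>s. \<phi> (x s)) \<longlongrightarrow> \<phi> z) F" by simp
  qed
qed

text \<open>Boundedness gives every proper filter below \<open>F\<close> a weak cluster point, which
  lies in \<open>S\<close>. Convergence of the distances to points of \<open>S\<close> leaves room
  for only one such point, and a unique cluster point must be the weak limit.\<close>

lemma opial:
  fixes x :: "'b \<Rightarrow> 'a::{real_inner,complete_space}"
  assumes "F \<noteq> bot" "S \<noteq> {}"
    and conv: "\<And>z. z \<in> S \<Longrightarrow> \<exists>l. ((\<lambda>s. (norm (x s - z))\<^sup>2) \<longlongrightarrow> l) F"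
    and cluster: "\<And>G z. G \<noteq> bot \<Longrightarrow> G \<le> F \<Longrightarrow> weakly_tendsto x z G \<Longrightarrow> z \<in> S"
  shows "\<exists>z\<in>S. weakly_tendsto x z F"
proof -
  obtain w l where "w \<in> S" and l: "((\<lambda>s. (norm (x s - w))\<^sup>2) \<longlongrightarrow> l) F"
    using \<open>S \<noteq> {}\<close> conv by blast
  have bnd: "eventually (\<lambda>s. norm (x s) \<le> norm w + sqrt (l + 1)) F"
    using order_tendstoD(2)[OF l, of "l + 1", simplified]
  proof eventually_elim
    case (elim s)
    then have "norm (x s - w) \<le> sqrt (l + 1)" by (intro real_le_rsqrt) simp
    then show ?case using norm_triangle_sub[of "x s" w] by simp
  qed
  have cl: "\<exists>H z. H \<noteq> bot \<and> H \<le> G \<and> weakly_tendsto x z H \<and> z \<in> S"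
    if "G \<noteq> bot" "G \<le> F" for G
  proof -
    obtain H z where H: "H \<noteq> bot" "H \<le> G" "\<And>h. ((\<lambda>s. x s \<bullet> h) \<longlongrightarrow> z \<bullet> h) H"
      using bounded_has_weak_cluster_point[OF \<open>G \<noteq> bot\<close> filter_leD[OF \<open>G \<le> F\<close> bnd]] by metis
    then have "weakly_tendsto x z H" by (simp add: weakly_tendsto_iff_inner)
    moreover have "z \<in> S" using cluster H that \<open>weakly_tendsto x z H\<close> order_trans by metis
    ultimately show ?thesis using H by blast
  qed
  have uniq: "z = z'"
    if "G \<noteq> bot" "G \<le> F" "weakly_tendsto x z G" "z \<in> S"
      "G' \<noteq> bot" "G' \<le> F" "weakly_tendsto x z' G'" "z' \<in> S" for G G' z z'
  proof -
    \<comment> \<open>The terms \<open>(norm (x s))\<^sup>2\<close> cancel in the difference of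
      squares, so this inner product converges along all of \<open>F\<close>. Its limit can then be
      read off at either cluster point.\<close>
    have eq: "x s \<bullet> (z - z') = ((norm (x s - z'))\<^sup>2 - (norm (x s - z))\<^sup>2 + (norm z)\<^sup>2 - (norm z')\<^sup>2) / 2" for s
      by (simp add: power2_norm_eq_inner inner_diff inner_commute)
    obtain a b where "((\<lambda>s. (norm (x s - z))\<^sup>2) \<longlongrightarrow> a) F" "((\<lambda>s. (norm (x s - z'))\<^sup>2) \<longlongrightarrow> b) F"
      using conv \<open>z \<in> S\<close> \<open>z' \<in> S\<close> by blast
    then have lim: "((\<lambda>s. x s \<bullet> (z - z')) \<longlongrightarrow> (b - a + (norm z)\<^sup>2 - (norm z')\<^sup>2) / 2) F"
      unfolding eq by (intro tendsto_intros) auto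
    have "z \<bullet> (z - z') = (b - a + (norm z)\<^sup>2 - (norm z')\<^sup>2) / 2"
      using tendsto_unique[OF \<open>G \<noteq> bot\<close> _ tendsto_mono[OF \<open>G \<le> F\<close> lim]] that(3)
      by (simp add: weakly_tendsto_iff_inner)
    moreover have "z' \<bullet> (z - z') = (b - a + (norm z)\<^sup>2 - (norm z')\<^sup>2) / 2"
      using tendsto_unique[OF \<open>G' \<noteq> bot\<close> _ tendsto_mono[OF \<open>G' \<le> F\<close> lim]] that(7)
      by (simp add: weakly_tendsto_iff_inner)
    ultimately have "(z - z') \<bullet> (z - z') = 0" by (simp add: inner_diff_left)
    then show ?thesis by simp
  qed
  obtain G z where G: "G \<noteq> bot" "G \<le> F" "weakly_tendsto x z G" "z \<in> S"
    using cl[OF \<open>F \<noteq> bot\<close> order_refl] by blast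
  have "((\<lambda>s. x s \<bullet> h) \<longlongrightarrow> z \<bullet> h) F" for h
  proof (rule tendstoI, rule ccontr)
    fix e :: real
    assume "e > 0" and not: "\<not> (\<forall>\<^sub>F s in F. dist (x s \<bullet> h) (z \<bullet> h) < e)"
    \<comment> \<open>If convergence fails, restricting \<open>F\<close> to the bad parameters
      leaves a proper filter. Its weak cluster point must again be \<open>z\<close>, although
      \<open>x s \<bullet> h\<close> stays at distance \<open>e\<close> from
      \<open>z \<bullet> h\<close>.\<close>
    define F' where "F' = inf F (principal {s. \<not> dist (x s \<bullet> h) (z \<bullet> h) < e})"
    have "F' \<noteq> bot" "F' \<le> F"
      using not by (auto simp: F'_def trivial_limit_def eventually_inf_principal)
    then obtain H z' where H: "H \<noteq> bot" "H \<le> F'" "weakly_tendsto x z' H" "z' \<in> S"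
      using cl by blast
    with \<open>F' \<le> F\<close> G have "z' = z" using uniq order_trans by blast
    with H have "((\<lambda>s. x s \<bullet> h) \<longlongrightarrow> z \<bullet> h) H" by (simp add: weakly_tendsto_iff_inner)
    then have "eventually (\<lambda>s. dist (x s \<bullet> h) (z \<bullet> h) < e) H" using \<open>e > 0\<close> by (rule tendstoD)
    moreover have "eventually (\<lambda>s. \<not> dist (x s \<bullet> h) (z \<bullet> h) < e) H"
      using H(2) by (rule filter_leD) (simp add: F'_def eventually_inf_principal)
    ultimately have "eventually (\<lambda>_. False) H" by eventually_elim blast
    with H show False by (simp add: trivial_limit_def)
  qed
  then show ?thesis using \<open>z \<in> S\<close> by (auto simp: weakly_tendsto_iff_inner)
qed

section \<open>Convexity, derivatives and limits\<close>

text \<open>Restricted to the line through \<open>y\<close> and \<open>z\<close>, the function is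
  convex in one variable, and its tangent at \<open>0\<close> is compared with its value at
  \<open>1\<close>.\<close>

lemma convex_gradient_inequality:
  assumes "convex_on UNIV f" "GDERIV f y :> g"
  shows "g \<bullet> (z - y) \<le> f z - f y"
proof -
  define \<phi> where "\<phi> t = f (y + t *\<^sub>R (z - y))" for t
  have "convex_on UNIV \<phi>"
  proof (rule convex_onI)
    fix t a b :: real assume t: "0 < t" "t < 1"
    have "y + ((1 - t) * a + t * b) *\<^sub>R (z - y)
        = (1 - t) *\<^sub>R (y + a *\<^sub>R (z - y)) + t *\<^sub>R (y + b *\<^sub>R (z - y))"
      by (simp add: algebra_simps)
    then show "\<phi> ((1 - t) *\<^sub>R a + t *\<^sub>R b) \<le> (1 - t) * \<phi> a + t * \<phi> b"
      using convex_onD[OF assms(1), of t] t by (simp add: \<phi>_def)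
  qed simp
  moreover have "(\<phi> has_real_derivative g \<bullet> (z - y)) (at 0)"
  proof -
    have "((\<lambda>t. y + t *\<^sub>R (z - y)) has_derivative (\<lambda>t. t *\<^sub>R (z - y))) (at 0)"
      by (auto intro!: derivative_eq_intros)
    moreover have "(f has_derivative (\<lambda>h. h \<bullet> g)) (at (y + 0 *\<^sub>R (z - y)))"
      using assms(2) by (simp add: gderiv_def)
    ultimately show ?thesis
      unfolding \<phi>_def has_field_derivative_def
      by (rule has_derivative_eq_rhs[OF has_derivative_compose]) (simp add: inner_commute mult.commute fun_eq_iff)
  qed
  ultimately show ?thesis
    using convex_on_imp_above_tangent[of UNIV \<phi> 0 1 "g \<bullet> (z - y)"] by (simp add: \<phi>_def)
qed

lemma has_real_derivative_inner:
  assumes "(a has_vector_derivative a') (at s)" "(b has_vector_derivative b') (at s)"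
  shows "((\<lambda>s. a s \<bullet> b s) has_real_derivative a s \<bullet> b' + a' \<bullet> b s) (at (s::real))"
  using has_derivative_inner[OF assms[unfolded has_vector_derivative_def]]
  unfolding has_field_derivative_def
  by (rule has_derivative_eq_rhs) (simp add: fun_eq_iff algebra_simps)

lemma nonincreasing_bounded_below_tendsto:
  fixes g :: "real \<Rightarrow> real"
  assumes "\<And>s t. a < s \<Longrightarrow> s \<le> t \<Longrightarrow> g t \<le> g s" "\<And>s. a < s \<Longrightarrow> B \<le> g s"
  obtains l where "(g \<longlongrightarrow> l) at_top"
proof
  have bdd: "bdd_below (g ` {a<..})" using assms(2) by (auto simp: bdd_below_def)
  show "(g \<longlongrightarrow> Inf (g ` {a<..})) at_top"
  proof (rule decreasing_tendsto)
    show "\<forall>\<^sub>F s in at_top. Inf (g ` {a<..}) \<le> g s"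
      using eventually_gt_at_top[of a] by eventually_elim (auto intro: cInf_lower bdd)
    fix c assume "Inf (g ` {a<..}) < c"
    then obtain s where "a < s" "g s < c"
      using cInf_lessD[of "g ` {a<..}" c] by auto
    then show "\<forall>\<^sub>F t in at_top. g t < c"
      by (intro eventually_mono[OF eventually_ge_at_top[of s]])
         (rule le_less_trans[OF assms(1)[OF \<open>a < s\<close>] \<open>g s < c\<close>])
  qed
qed

text \<open>The quotient \<open>s\<^sup>c h(s) / s\<^sup>c\<close> has derivative quotient \<open>h(s) + s h'(s) / c\<close>.\<close>

lemma tendsto_of_euler_operator:
  fixes h h' :: "real \<Rightarrow> real"
  assumes "c > 0" and dh: "eventually (\<lambda>s. (h has_real_derivative h' s) (at s)) at_top"
    and lim: "((\<lambda>s. h s + s * h' s / c) \<longlongrightarrow> l) at_top"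
  shows "(h \<longlongrightarrow> l) at_top"
proof -
  have "((\<lambda>s. (s powr c * h s) / s powr c) \<longlongrightarrow> l) at_top"
  \<comment> \<open>This form of l'Hospital's rule asks only the denominator to diverge, so nothing
    about the growth of \<open>h\<close> has to be known beforehand.\<close>
  proof (rule lhospital_at_top_at_top)
    show "filterlim (\<lambda>s::real. s powr c) at_top at_top"
      using \<open>c > 0\<close> by real_asymp
    show "\<forall>\<^sub>F s in at_top. c * s powr (c - 1) \<noteq> 0"
      using eventually_gt_at_top[of 0] by eventually_elim (use \<open>c > 0\<close> in simp)
    show "\<forall>\<^sub>F s in at_top. ((\<lambda>s. s powr c) has_real_derivative c * s powr (c - 1)) (at s)"
      using eventually_gt_at_top[of 0] by eventually_elim (auto intro!: derivative_eq_intros)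
    show "\<forall>\<^sub>F s in at_top. ((\<lambda>s. s powr c * h s) has_real_derivative
        c * s powr (c - 1) * h s + s powr c * h' s) (at s)"
      using eventually_gt_at_top[of 0] dh
      by eventually_elim (auto intro!: derivative_eq_intros)
    have "\<forall>\<^sub>F s in at_top. h s + s * h' s / c
        = (c * s powr (c - 1) * h s + s powr c * h' s) / (c * s powr (c - 1))"
      using eventually_gt_at_top[of 0]
      by eventually_elim (use \<open>c > 0\<close> in \<open>simp add: powr_diff field_simps\<close>)
    with lim show "((\<lambda>s. (c * s powr (c - 1) * h s + s powr c * h' s) / (c * s powr (c - 1))) \<longlongrightarrow> l) at_top"
      by (rule Lim_transform_eventually)
  qed
  moreover have "\<forall>\<^sub>F s in at_top. (s powr c * h s) / s powr c = h s"
    using eventually_gt_at_top[of 0] by eventually_elim simp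
  ultimately show ?thesis by (rule Lim_transform_eventually)
qed

section \<open>Energy estimates\<close>

text \<open>The equation appears as a first-order system for \<open>x\<close> and \<open>v\<close>,
  only on the open ray, where derivatives are two-sided. Convexity enters through the gradient
  inequality.\<close>

locale convex_avd_trajectory =
  fixes f :: "'a::{real_inner,complete_space} \<Rightarrow> real" and grad :: "'a \<Rightarrow> 'a"
    and \<alpha> s0 :: real and x v :: "real \<Rightarrow> 'a" and m :: real
  assumes alpha: "\<alpha> > 3" and s0: "s0 > 0"
    and gderiv: "\<And>y. GDERIV f y :> grad y"
    and gradient_inequality: "\<And>y z. grad y \<bullet> (z - y) \<le> f z - f y"
    and x_deriv: "\<And>s. s > s0 \<Longrightarrow> (x has_vector_derivative v s) (at s)"
    and v_deriv: "\<And>s. s > s0 \<Longrightarrow>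
      (v has_vector_derivative - (\<alpha> / s) *\<^sub>R v s - grad (x s)) (at s)"
    and min_le: "\<And>y. m \<le> f y" and min_attained: "\<exists>z. f z = m"
begin

definition mech :: "real \<Rightarrow> real" where
  "mech s = f (x s) - m + (v s \<bullet> v s) / 2"

text \<open>With \<open>h\<close> the squared distance to \<open>z\<close>, this is
  \<open>(\<alpha> - 1) / 2\<close> times \<open>h s + s * h' s / (\<alpha> - 1)\<close>, the
  expression handled by \<open>tendsto_of_euler_operator\<close>.\<close>

definition anchor :: "'a \<Rightarrow> real \<Rightarrow> real" where
  "anchor z s = s * ((x s - z) \<bullet> v s) + (\<alpha> - 1) / 2 * ((x s - z) \<bullet> (x s - z))"

text \<open>For \<open>l = \<alpha> - 1\<close> this is, up to a constant factor, the Lyapunov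
  function of Su, Boyd and Candes.\<close>

definition energy :: "'a \<Rightarrow> real \<Rightarrow> real \<Rightarrow> real" where
  "energy z l s = s\<^sup>2 * mech s + l * anchor z s"

lemma mech_nonneg: "0 \<le> mech s"
  using min_le[of "x s"] by (simp add: mech_def)

lemma f_x_deriv:
  assumes "s > s0"
  shows "((\<lambda>s. f (x s)) has_real_derivative grad (x s) \<bullet> v s) (at s)"
  using has_derivative_compose[OF x_deriv[OF assms, unfolded has_vector_derivative_def]
      gderiv[of "x s", unfolded gderiv_def]]
  unfolding has_field_derivative_def
  by (rule has_derivative_eq_rhs) (simp add: fun_eq_iff inner_commute mult.commute)

lemma dist_deriv:
  assumes "s > s0"
  shows "((\<lambda>s. (x s - z) \<bullet> (x s - z)) has_real_derivative 2 * ((x s - z) \<bullet> v s)) (at s)"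
proof -
  have "((\<lambda>s. x s - z) has_vector_derivative v s) (at s)"
    using has_vector_derivative_diff[OF x_deriv[OF assms] has_vector_derivative_const] by simp
  from has_real_derivative_inner[OF this this] show ?thesis by (simp add: inner_commute)
qed

text \<open>Once the equation replaces the derivative of \<open>v\<close>, the terms in
  \<open>grad (x s) \<bullet> v s\<close> cancel inside \<open>mech\<close>. The weight
  \<open>(\<alpha> - 1) / 2\<close> in \<open>anchor\<close> is the one that cancels the terms in
  \<open>(x s - z) \<bullet> v s\<close>.\<close>

lemma energy_deriv:
  assumes "s > s0"
  shows "(energy z l has_real_derivative
    2 * s * (f (x s) - m) - l * s * (grad (x s) \<bullet> (x s - z)) - (\<alpha> - 1 - l) * s * (v s \<bullet> v s)) (at s)"
proof -
  have "s > 0" using assms s0 by simp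
  have xz: "((\<lambda>s. x s - z) has_vector_derivative v s) (at s)"
    using has_vector_derivative_diff[OF x_deriv[OF assms] has_vector_derivative_const] by simp
  have E: "energy z l = (\<lambda>s. s\<^sup>2 * (f (x s) - m + (v s \<bullet> v s) / 2)
      + l * (s * ((x s - z) \<bullet> v s) + (\<alpha> - 1) / 2 * ((x s - z) \<bullet> (x s - z))))"
    by (simp add: fun_eq_iff energy_def mech_def anchor_def)
  define V P Q R where "V = v s \<bullet> v s" and "P = (x s - z) \<bullet> v s"
    and "Q = grad (x s) \<bullet> v s" and "R = grad (x s) \<bullet> (x s - z)"
  have fx: "((\<lambda>s. f (x s)) has_real_derivative Q) (at s)"
    unfolding Q_def by (rule f_x_deriv[OF assms])
  have vv: "((\<lambda>s. v s \<bullet> v s) has_real_derivative - 2 * (\<alpha> / s) * V - 2 * Q) (at s)"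
    by (rule DERIV_cong[OF has_real_derivative_inner[OF v_deriv[OF assms] v_deriv[OF assms]]])
       (simp add: V_def Q_def inner_diff inner_commute)
  have xv: "((\<lambda>s. (x s - z) \<bullet> v s) has_real_derivative - (\<alpha> / s) * P - R + V) (at s)"
    by (rule DERIV_cong[OF has_real_derivative_inner[OF xz v_deriv[OF assms]]])
       (simp add: V_def P_def R_def inner_diff inner_commute)
  have xx: "((\<lambda>s. (x s - z) \<bullet> (x s - z)) has_real_derivative 2 * P) (at s)"
    unfolding P_def by (rule dist_deriv[OF assms])
  show ?thesis
    unfolding E
  proof (rule DERIV_cong)
    show "((\<lambda>s. s\<^sup>2 * (f (x s) - m + (v s \<bullet> v s) / 2)
      + l * (s * ((x s - z) \<bullet> v s) + (\<alpha> - 1) / 2 * ((x s - z) \<bullet> (x s - z)))) has_real_derivative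
      2 * s * (f (x s) - m + V / 2) + (Q + (- 2 * (\<alpha> / s) * V - 2 * Q) / 2) * s\<^sup>2
      + l * (1 * P + (- (\<alpha> / s) * P - R + V) * s + (\<alpha> - 1) / 2 * (2 * P))) (at s)"
      using DERIV_add[OF DERIV_mult[OF DERIV_pow[of 2] DERIV_add[OF DERIV_diff[OF fx DERIV_const[of m]]
            DERIV_cdivide[OF vv, of 2]]]
          DERIV_cmult[OF DERIV_add[OF DERIV_mult[OF DERIV_ident xv] DERIV_cmult[OF xx, of "(\<alpha> - 1) / 2"]], of l]]
      unfolding V_def[symmetric] P_def[symmetric] by simp
  qed (use \<open>s > 0\<close> in \<open>simp add: V_def[symmetric] R_def[symmetric] field_simps power2_eq_square\<close>)
qed

text \<open>Completing the square with \<open>?u\<close> leaves a sum of three terms, each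
  nonnegative for \<open>l\<close> in this range.\<close>

lemma energy_nonneg:
  assumes "0 \<le> l" "l \<le> \<alpha> - 1"
  shows "0 \<le> energy z l s"
proof -
  let ?u = "l *\<^sub>R (x s - z) + s *\<^sub>R v s"
  have "energy z l s = s\<^sup>2 * (f (x s) - m) + (?u \<bullet> ?u) / 2
      + l * (\<alpha> - 1 - l) / 2 * ((x s - z) \<bullet> (x s - z))"
    unfolding energy_def mech_def anchor_def inner_add_left inner_add_right inner_scaleR_left
      inner_scaleR_right inner_commute[of "v s" "x s - z"]
    by (simp add: field_simps power2_eq_square)
  moreover have "0 \<le> f (x s) - m" using min_le[of "x s"] by simp
  ultimately show ?thesis using assms by simp
qed

text \<open>The gradient inequality bounds the dissipation below by the right-hand side of the
  condition on \<open>D'\<close>. Any \<open>D\<close> growing no faster may be added: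
  \<open>D = 0\<close> gives monotonicity, a logarithm gives the decay of
  \<open>mech\<close>.\<close>

lemma energy_decreases:
  assumes "f z = m" "2 \<le> l" "l \<le> \<alpha> - 1" "s0 < s" "s \<le> t"
    and D: "\<And>r. s \<le> r \<Longrightarrow> (D has_real_derivative D' r) (at r)"
    and D': "\<And>r. s \<le> r \<Longrightarrow> D' r \<le> r * ((l - 2) * (f (x r) - m) + (\<alpha> - 1 - l) * (v r \<bullet> v r))"
  shows "energy z l t + D t \<le> energy z l s + D s"
proof (rule DERIV_nonpos_imp_nonincreasing[OF \<open>s \<le> t\<close>])
  fix r assume "s \<le> r"
  then have "r > s0" "r > 0" using assms s0 by auto
  have "f (x r) - m \<le> grad (x r) \<bullet> (x r - z)"
    using gradient_inequality[of "x r" z] \<open>f z = m\<close> by (simp add: inner_diff)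
  then have "l * r * (f (x r) - m) \<le> l * r * (grad (x r) \<bullet> (x r - z))"
    using \<open>2 \<le> l\<close> \<open>r > 0\<close> by (intro mult_left_mono) auto
  moreover have "((\<lambda>r. energy z l r + D r) has_real_derivative
     (2 * r * (f (x r) - m) - l * r * (grad (x r) \<bullet> (x r - z)) - (\<alpha> - 1 - l) * r * (v r \<bullet> v r)) + D' r) (at r)"
    by (intro derivative_intros energy_deriv \<open>r > s0\<close> D \<open>s \<le> r\<close>)
  ultimately show "\<exists>y. ((\<lambda>r. energy z l r + D r) has_real_derivative y) (at r) \<and> y \<le> 0"
    using D'[OF \<open>s \<le> r\<close>] by (intro exI conjI) (assumption, simp add: algebra_simps)
qed

section \<open>Convergence of the energies and of the distances to minimisers\<close>

lemma energy_convergent: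
  assumes "f z = m" "2 \<le> l" "l \<le> \<alpha> - 1"
  obtains L where "(energy z l \<longlongrightarrow> L) at_top"
proof (rule nonincreasing_bounded_below_tendsto[of s0 "energy z l" 0])
  fix s t assume "s0 < s" "s \<le> t"
  then show "energy z l t \<le> energy z l s"
    using energy_decreases[OF assms \<open>s0 < s\<close> \<open>s \<le> t\<close>, of "\<lambda>_. 0" "\<lambda>_. 0"] assms min_le s0
    by (auto intro!: mult_nonneg_nonneg add_nonneg_nonneg)
qed (use assms energy_nonneg in auto)

text \<open>The parameters \<open>2\<close> and \<open>\<alpha> - 1\<close> are distinct because
  \<open>\<alpha> > 3\<close>, and the part \<open>s\<^sup>2 * mech s\<close> drops out of the
  difference of the two energies.\<close>

lemma anchor_convergent:
  assumes "f z = m"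
  obtains p where "(anchor z \<longlongrightarrow> p) at_top"
proof -
  have "2 \<le> \<alpha> - 1" using alpha by simp
  then obtain L M where "(energy z 2 \<longlongrightarrow> L) at_top" "(energy z (\<alpha> - 1) \<longlongrightarrow> M) at_top"
    using energy_convergent[OF assms] by (metis order_refl)
  then have "((\<lambda>s. (energy z (\<alpha> - 1) s - energy z 2 s) / (\<alpha> - 3)) \<longlongrightarrow> (M - L) / (\<alpha> - 3)) at_top"
    using alpha by (intro tendsto_intros) auto
  moreover have "(\<lambda>s. (energy z (\<alpha> - 1) s - energy z 2 s) / (\<alpha> - 3)) = anchor z"
    using alpha by (simp add: fun_eq_iff energy_def field_simps)
  ultimately show thesis using that by simp
qed

lemma dist_minimizer_convergent:
  assumes "f z = m"
  shows "\<exists>l. ((\<lambda>s. (norm (x s - z))\<^sup>2) \<longlongrightarrow> l) at_top"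
proof -
  obtain p where p: "(anchor z \<longlongrightarrow> p) at_top" using anchor_convergent[OF assms] .
  have "((\<lambda>s. (x s - z) \<bullet> (x s - z)) \<longlongrightarrow> p / ((\<alpha> - 1) / 2)) at_top"
  proof (rule tendsto_of_euler_operator)
    show "\<alpha> - 1 > 0" using alpha by simp
    show "\<forall>\<^sub>F s in at_top. ((\<lambda>s. (x s - z) \<bullet> (x s - z)) has_real_derivative 2 * ((x s - z) \<bullet> v s)) (at s)"
      using eventually_gt_at_top[of s0] by eventually_elim (rule dist_deriv)
    have "((\<lambda>s. anchor z s / ((\<alpha> - 1) / 2)) \<longlongrightarrow> p / ((\<alpha> - 1) / 2)) at_top"
      using alpha by (intro tendsto_intros p) auto
    moreover have "anchor z s / ((\<alpha> - 1) / 2)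
        = (x s - z) \<bullet> (x s - z) + s * (2 * ((x s - z) \<bullet> v s)) / (\<alpha> - 1)" for s
      using alpha by (simp add: anchor_def field_simps)
    ultimately show "((\<lambda>s. (x s - z) \<bullet> (x s - z) + s * (2 * ((x s - z) \<bullet> v s)) / (\<alpha> - 1))
        \<longlongrightarrow> p / ((\<alpha> - 1) / 2)) at_top"
      by simp
  qed
  then show ?thesis by (auto simp: power2_norm_eq_inner)
qed

section \<open>Decay of the mechanical energy and the two rates\<close>

lemma mech_tendsto: "((\<lambda>s. s\<^sup>2 * mech s) \<longlongrightarrow> 0) at_top"
proof -
  obtain z where z: "f z = m" using min_attained by blast
  \<comment> \<open>The midpoint of the interval from \<open>2\<close> to
    \<open>\<alpha> - 1\<close> makes both dissipation coefficients \<open>l - 2\<close> and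
    \<open>\<alpha> - 1 - l\<close> equal to \<open>(\<alpha> - 3) / 2\<close>, which is
    positive.\<close>
  define l where "l = (\<alpha> + 1) / 2"
  have l: "2 \<le> l" "l \<le> \<alpha> - 1" using alpha by (auto simp: l_def)
  obtain L p where L: "(energy z l \<longlongrightarrow> L) at_top" and p: "(anchor z \<longlongrightarrow> p) at_top"
    using energy_convergent[OF z l] anchor_convergent[OF z] by metis
  define q where "q = L - l * p"
  have "((\<lambda>s. energy z l s - l * anchor z s) \<longlongrightarrow> q) at_top"
    unfolding q_def by (intro tendsto_intros L p)
  then have q: "((\<lambda>s. s\<^sup>2 * mech s) \<longlongrightarrow> q) at_top" by (simp add: energy_def)
  have "q \<ge> 0" by (rule tendsto_lowerbound[OF q]) (auto simp: mech_nonneg)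
  \<comment> \<open>A positive limit would keep the dissipation above \<open>c / r\<close> for large
    \<open>r\<close>. Its integral \<open>c * ln r\<close> is unbounded, whereas the energy can only
    fall to zero.\<close>
  moreover have "\<not> q > 0"
  proof
    assume "q > 0"
    \<comment> \<open>The common dissipation coefficient times \<open>q / 2\<close>, an eventual
      lower bound for \<open>s\<^sup>2 * mech s\<close>.\<close>
    define c where "c = (\<alpha> - 3) / 2 * (q / 2)"
    have "c > 0" using \<open>q > 0\<close> alpha by (simp add: c_def)
    have "eventually (\<lambda>s. q / 2 < s\<^sup>2 * mech s) at_top"
      using order_tendstoD(1)[OF q, of "q / 2"] \<open>q > 0\<close> by simp
    then obtain N where N: "\<And>s. s \<ge> N \<Longrightarrow> q / 2 < s\<^sup>2 * mech s"
      unfolding eventually_at_top_linorder by blast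
    define s where "s = max N (s0 + 1)"
    have s: "s > s0" "s > 0" "s \<ge> N" using s0 by (auto simp: s_def)
    have dec: "energy z l t + c * ln t \<le> energy z l s + c * ln s" if "s \<le> t" for t
    proof (rule energy_decreases[OF z l \<open>s > s0\<close> that])
      fix r assume "s \<le> r"
      then have r: "r > 0" "r \<ge> N" using s by auto
      show "((\<lambda>r. c * ln r) has_real_derivative c / r) (at r)"
        using r by (auto intro!: derivative_eq_intros)
      have "c / r \<le> (\<alpha> - 3) / 2 * (r\<^sup>2 * mech r) / r"
        unfolding c_def using alpha r N[of r] by (intro divide_right_mono mult_left_mono) auto
      also have "\<dots> = r * ((\<alpha> - 3) / 2 * mech r)"
        using r by (simp add: power2_eq_square)
      also have "\<dots> \<le> r * ((l - 2) * (f (x r) - m) + (\<alpha> - 1 - l) * (v r \<bullet> v r))"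
      proof -
        have "(\<alpha> - 3) / 2 * (v r \<bullet> v r / 2) \<le> (\<alpha> - 3) / 2 * (v r \<bullet> v r)"
          using alpha by (intro mult_left_mono) auto
        then have "(\<alpha> - 3) / 2 * mech r \<le> (l - 2) * (f (x r) - m) + (\<alpha> - 1 - l) * (v r \<bullet> v r)"
          by (simp add: mech_def l_def field_simps)
        then show ?thesis using r by (intro mult_left_mono) auto
      qed
      finally show "c / r \<le> r * ((l - 2) * (f (x r) - m) + (\<alpha> - 1 - l) * (v r \<bullet> v r))" .
    qed
    define B where "B = (energy z l s + c * ln s) / c"
    have "eventually (\<lambda>t. B < ln t) at_top"
      using ln_at_top by (simp add: filterlim_at_top_dense)
    then have "eventually (\<lambda>t. B < ln t \<and> s \<le> t) at_top"
      using eventually_ge_at_top by (rule eventually_conj)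
    then obtain t where t: "B < ln t" "s \<le> t"
      using eventually_happens by force
    have "c * ln t \<le> energy z l s + c * ln s"
      using dec[OF t(2)] energy_nonneg[of l z t] l by simp
    then have "ln t \<le> B" using \<open>c > 0\<close> by (simp add: B_def field_simps)
    with t show False by simp
  qed
  ultimately show ?thesis using q by simp
qed

lemma values_smallo: "(\<lambda>s. f (x s) - m) \<in> o[at_top](\<lambda>s. 1 / s\<^sup>2)"
proof (rule smalloI_tendsto)
  have "((\<lambda>s. s\<^sup>2 * (f (x s) - m)) \<longlongrightarrow> 0) at_top"
  proof (rule tendsto_sandwich[OF _ _ tendsto_const mech_tendsto])
    show "\<forall>\<^sub>F s in at_top. 0 \<le> s\<^sup>2 * (f (x s) - m)" using min_le by simp
    show "\<forall>\<^sub>F s in at_top. s\<^sup>2 * (f (x s) - m) \<le> s\<^sup>2 * mech s"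
      by (intro always_eventually allI mult_left_mono) (auto simp: mech_def)
  qed
  then show "((\<lambda>s. (f (x s) - m) / (1 / s\<^sup>2)) \<longlongrightarrow> 0) at_top" by (simp add: mult.commute)
  show "\<forall>\<^sub>F s in at_top. 1 / s\<^sup>2 \<noteq> (0::real)"
    using eventually_gt_at_top[of 0] by eventually_elim simp
qed

text \<open>The potential part of \<open>mech\<close> is nonnegative, so
  \<open>v s \<bullet> v s\<close> is at most \<open>2 * mech s\<close>. Taking roots turns the rate
  for \<open>mech\<close> into that for the speed.\<close>

lemma velocity_smallo: "(\<lambda>s. norm (v s)) \<in> o[at_top](\<lambda>s. 1 / s)"
proof (rule smalloI_tendsto)
  have "((\<lambda>s. sqrt (2 * (s\<^sup>2 * mech s))) \<longlongrightarrow> sqrt (2 * 0)) at_top"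
    by (intro tendsto_intros mech_tendsto)
  then have lim: "((\<lambda>s. sqrt (2 * (s\<^sup>2 * mech s))) \<longlongrightarrow> 0) at_top" by simp
  have "((\<lambda>s. norm (v s) * s) \<longlongrightarrow> 0) at_top"
  proof (rule tendsto_sandwich[OF _ _ tendsto_const lim])
    show "\<forall>\<^sub>F s in at_top. 0 \<le> norm (v s) * s"
      using eventually_ge_at_top[of 0] by eventually_elim simp
    have "norm (v s) * s \<le> sqrt (2 * (s\<^sup>2 * mech s))" for s
    proof (rule real_le_rsqrt)
      have "v s \<bullet> v s \<le> 2 * mech s" using min_le[of "x s"] by (simp add: mech_def)
      then have "s\<^sup>2 * (v s \<bullet> v s) \<le> s\<^sup>2 * (2 * mech s)" by (rule mult_left_mono) simp
      then show "(norm (v s) * s)\<^sup>2 \<le> 2 * (s\<^sup>2 * mech s)"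
        by (simp add: power_mult_distrib power2_norm_eq_inner mult.commute)
    qed
    then show "\<forall>\<^sub>F s in at_top. norm (v s) * s \<le> sqrt (2 * (s\<^sup>2 * mech s))" by simp
  qed
  then show "((\<lambda>s. norm (v s) / (1 / s)) \<longlongrightarrow> 0) at_top" by simp
  show "\<forall>\<^sub>F s in at_top. 1 / s \<noteq> (0::real)"
    using eventually_gt_at_top[of 0] by eventually_elim simp
qed

section \<open>Weak convergence to a minimiser\<close>

lemma values_tendsto: "((\<lambda>s. f (x s)) \<longlongrightarrow> m) at_top"
proof -
  have "(\<lambda>s. f (x s) - m) \<in> o[at_top](\<lambda>s. 1)"
    by (rule landau_o.small.trans[OF values_smallo]) real_asymp
  then have "((\<lambda>s. f (x s) - m) \<longlongrightarrow> 0) at_top"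
    using smalloD_tendsto by fastforce
  then show ?thesis by (rule LIM_zero_cancel)
qed

text \<open>Opial's lemma applies to the set of minimisers. That weak cluster points are minimisers
  is weak lower semicontinuity: the tangent to \<open>f\<close> at \<open>z\<close> lies below
  \<open>f\<close> and is weakly continuous, so its limit \<open>f z\<close> is at most
  \<open>m\<close>.\<close>

lemma weakly_convergent: "\<exists>z. f z = m \<and> weakly_tendsto x z at_top"
proof -
  have "\<exists>z\<in>{z. f z = m}. weakly_tendsto x z at_top"
  proof (rule opial)
    fix G z assume G: "G \<noteq> bot" "G \<le> at_top" "weakly_tendsto x z G"
    then have "((\<lambda>s. x s \<bullet> grad z) \<longlongrightarrow> z \<bullet> grad z) G" by (simp add: weakly_tendsto_iff_inner)
    then have "((\<lambda>s. f z + (x s \<bullet> grad z - z \<bullet> grad z)) \<longlongrightarrow> f z + (z \<bullet> grad z - z \<bullet> grad z)) G"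
      by (intro tendsto_add tendsto_diff tendsto_const)
    moreover have "f z + (x s \<bullet> grad z - z \<bullet> grad z) \<le> f (x s)" for s
      using gradient_inequality[of z "x s"] by (simp add: inner_diff inner_commute)
    ultimately have "f z + (z \<bullet> grad z - z \<bullet> grad z) \<le> m"
      using tendsto_le[OF \<open>G \<noteq> bot\<close> tendsto_mono[OF \<open>G \<le> at_top\<close> values_tendsto]] by simp
    then show "z \<in> {z. f z = m}" using min_le[of z] by simp
  qed (use min_attained dist_minimizer_convergent in auto)
  then show ?thesis by blast
qed

end

section \<open>Reduction of the theorem to the trajectory locale\<close>

theorem theorem3p2:
  fixes f :: "'a::{real_inner,complete_space} \<Rightarrow> real"
    and \<alpha> s0 :: real
    and x0 x1 :: 'a
    and x :: "real \<Rightarrow> 'a"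
  assumes "convex_on UNIV f"
    and "continuously_differentiable f"
    and "argmin f \<noteq> {}"
    and "\<alpha> > 3"
    and "s0 > 0"
    and "is_solution f \<alpha> s0 x0 x1 x"
  shows "(\<lambda>s. f (x s) - (INF z. f z)) \<in> o[at_top](\<lambda>s. 1 / s\<^sup>2) \<and>
         (\<lambda>s. norm (velocity s0 x s)) \<in> o[at_top](\<lambda>s. 1 / s) \<and>
         (\<exists>z \<in> argmin f. weakly_tendsto x z at_top)"
proof -
  define m where "m = (INF z. f z)"
  obtain w where "w \<in> argmin f" using assms(3) by blast
  then have w: "f w \<le> f y" for y
    by (simp add: argmin_def is_arg_min_def not_less)
  have "m = f w"
    unfolding m_def using w by (intro cInf_eq_minimum) auto
  have argmin: "argmin f = {z. f z = m}"
    using w \<open>m = f w\<close> by (auto simp: argmin_def is_arg_min_def not_less intro: order_antisym)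
  have g: "GDERIV f y :> gradient f y" for y
    using assms(2) by (intro gderiv_gradient) (auto simp: continuously_differentiable_def differentiable_def)
  have sol: "x differentiable_on {s0..}" "velocity s0 x differentiable_on {s0..}"
    "\<And>s. s \<ge> s0 \<Longrightarrow> acceleration s0 x s + (\<alpha> / s) *\<^sub>R velocity s0 x s + gradient f (x s) = 0"
    using assms(6) by (auto simp: is_solution_def twice_continuously_differentiable_def)
  \<comment> \<open>Beyond \<open>s0\<close> the point is interior to \<open>{s0..}\<close>, so the
    derivative within the ray is an ordinary two-sided one.\<close>
  have D: "(y has_vector_derivative vector_derivative y (at s within {s0..})) (at s)"
    if "y differentiable_on {s0..}" "s > s0" for y :: "real \<Rightarrow> 'a" and s
  proof -
    have "at s within {s0..} = at s"
      using that by (intro at_within_interior) simp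
    moreover have "y differentiable (at s within {s0..})"
      using that by (simp add: differentiable_on_def)
    ultimately show ?thesis by (metis vector_derivative_works)
  qed
  interpret convex_avd_trajectory f "gradient f" \<alpha> s0 x "velocity s0 x" m
  proof
    show "\<alpha> > 3" "s0 > 0" by fact+
    show "GDERIV f y :> gradient f y" for y by (rule g)
    show "gradient f y \<bullet> (z - y) \<le> f z - f y" for y z
      by (rule convex_gradient_inequality[OF assms(1) g])
    show "(x has_vector_derivative velocity s0 x s) (at s)" if "s > s0" for s
      using D[OF sol(1) that] by (simp add: velocity_def)
    show "(velocity s0 x has_vector_derivative - (\<alpha> / s) *\<^sub>R velocity s0 x s - gradient f (x s)) (at s)"
      if "s > s0" for s
    proof -
      \<comment> \<open>The differential equation solved for the acceleration, as the locale expects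
        it.\<close>
      have "acceleration s0 x s = - (\<alpha> / s) *\<^sub>R velocity s0 x s - gradient f (x s)"
        using sol(3)[of s] that by (simp add: eq_neg_iff_add_eq_0 algebra_simps)
      with D[OF sol(2) that] show ?thesis by (simp add: acceleration_def)
    qed
    show "m \<le> f y" for y using w \<open>m = f w\<close> by simp
    show "\<exists>z. f z = m" using \<open>m = f w\<close> by auto
  qed
  show ?thesis
    using values_smallo velocity_smallo weakly_convergent
    unfolding argmin m_def[symmetric] by auto
qed

end
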